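(* Let $G$ be a bipartite graph on $n$ vertices with parts $X$ and $Y$, and let $k=\operatorname{rank}_{\mathbb{F}_2}(M)$, where $M\in\mathbb{F}_2^{X\times Y}$ is the bipartite adjacency matrix of $G$. If $\delta(G)\ge 1$, then $f_o(G)\ge \frac n2-2k$.
   Context: All graphs are finite and simple (no loops, no multiple edges). The bipartite adjacency matrix $M$ has rows indexed by $X$, columns indexed by $Y$, and $(x,y)$ entry $1$ if $xy\in E(G)$ and $0$ otherwise; its rank is taken over $\mathbb{F}_2$. $f_o(G)$ denotes the maximum size of a set $S\subseteq V(G)$ such that every vertex of the induced subgraph $G[S]$ has odd degree in $G[S]$ (the empty set is vacuously allowed). *)

theory Defs
  imports
    Complex_Main
    "HOL-Library.Z2"
    "HOL-Library.Extended_Nat"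
    "Jordan_Normal_Form.DL_Rank"
begin

definition simple_graph :: "'a set \<Rightarrow> ('a \<Rightarrow> 'a \<Rightarrow> bool) \<Rightarrow> bool" where
  "simple_graph V E \<longleftrightarrow>
     finite V \<and> (\<forall>u v. E u v \<longrightarrow> u \<in> V \<and> v \<in> V) \<and> symp E \<and> irreflp E"

definition bipartition :: "'a set \<Rightarrow> ('a \<Rightarrow> 'a \<Rightarrow> bool) \<Rightarrow> 'a set \<Rightarrow> 'a set \<Rightarrow> bool" where
  "bipartition V E X Y \<longleftrightarrow>
     X \<union> Y = V \<and> X \<inter> Y = {} \<and>
     (\<forall>u v. E u v \<longrightarrow> (u \<in> X \<and> v \<in> Y) \<or> (u \<in> Y \<and> v \<in> X))"

definition vertex_degree :: "'a set \<Rightarrow> ('a \<Rightarrow> 'a \<Rightarrow> bool) \<Rightarrow> 'a \<Rightarrow> nat" where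
  "vertex_degree V E v = card {u \<in> V. E v u}"

(* The infimum is taken in the extended naturals, so that the graph without
   vertices has minimum degree infinity rather than an unspecified value. *)
definition min_degree :: "'a set \<Rightarrow> ('a \<Rightarrow> 'a \<Rightarrow> bool) \<Rightarrow> enat" where
  "min_degree V E = (INF v\<in>V. enat (vertex_degree V E v))"

definition induced_edges :: "('a \<Rightarrow> 'a \<Rightarrow> bool) \<Rightarrow> 'a set \<Rightarrow> 'a \<Rightarrow> 'a \<Rightarrow> bool" where
  "induced_edges E S u v \<longleftrightarrow> u \<in> S \<and> v \<in> S \<and> E u v"

definition f_o :: "'a set \<Rightarrow> ('a \<Rightarrow> 'a \<Rightarrow> bool) \<Rightarrow> nat" where
  "f_o V E = Max {card S | S. S \<subseteq> V \<and> (\<forall>v\<in>S. odd (vertex_degree S (induced_edges E S) v))}"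

(* Library matrices are indexed by initial segments of the naturals: the lists xs and ys
   enumerate the parts X and Y, thereby ordering the rows and columns. The rank does not
   depend on the enumerations. *)
definition bipartite_adj_mat :: "('a \<Rightarrow> 'a \<Rightarrow> bool) \<Rightarrow> 'a list \<Rightarrow> 'a list \<Rightarrow> bit mat" where
  "bipartite_adj_mat E xs ys =
     mat (length xs) (length ys) (\<lambda>(i, j). if E (xs ! i) (ys ! j) then 1 else 0)"

end

theory Submission
  imports Defs
begin

text \<open>Over the two-element field, pick \<open>T \<subseteq> Y\<close> so that the set \<open>P\<close> of the \<open>x \<in> X\<close> with an odd number
  of neighbours in \<open>T\<close> is as large as possible; averaging over \<open>T\<close> gives \<open>\<bar>P\<bar> \<ge> \<bar>X\<bar> / 2\<close>. By
  maximality the rows of \<open>P\<close> span all rows, so at most \<open>k\<close> elements of \<open>P\<close> need to be deleted to give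
  the sum of the remaining rows any prescribed value in the row space. Choose \<open>U \<subseteq> X\<close> and \<open>Q \<subseteq> Y\<close>
  in the same way for the transposed matrix, delete from \<open>P\<close> to make its row sum equal to that of
  \<open>U\<close>, and delete from \<open>Q\<close> to make its column sum equal to that of \<open>T\<close>. Then all degrees in the
  union of the two remaining sets are odd.\<close>

section \<open>Linear forms on the rows of a matrix over a field\<close>

text \<open>This is entry \<open>x\<close> of the matrix-vector product of \<open>M\<close> with
  \<open>t\<close>. Over the two-element field \<open>t\<close> is the indicator of a set T, and the
  value is the parity of the number of neighbours of \<open>x\<close> in T.\<close>

definition lin_form :: "'b set \<Rightarrow> ('a \<Rightarrow> 'b \<Rightarrow> 'f::field) \<Rightarrow> ('b \<Rightarrow> 'f) \<Rightarrow> 'a \<Rightarrow> 'f" where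
  "lin_form Y M t x = (\<Sum>y\<in>Y. M x y * t y)"

text \<open>Linear independence of the rows is encoded dually: every prescription of values on the
  rows is attained by some linear form.\<close>

definition rows_indep :: "'b set \<Rightarrow> ('a \<Rightarrow> 'b \<Rightarrow> 'f::field) \<Rightarrow> 'a set \<Rightarrow> bool" where
  "rows_indep Y M B \<longleftrightarrow> (\<forall>c. \<exists>t. \<forall>x\<in>B. lin_form Y M t x = c x)"

definition rows_span :: "'b set \<Rightarrow> ('a \<Rightarrow> 'b \<Rightarrow> 'f::field) \<Rightarrow> 'a set \<Rightarrow> 'a set \<Rightarrow> bool" where
  "rows_span Y M B X \<longleftrightarrow> (\<forall>x\<in>X. \<exists>c. \<forall>y\<in>Y. M x y = (\<Sum>i\<in>B. c i * M i y))"

lemma lin_form_add: "lin_form Y M (\<lambda>y. s y + t y) x = lin_form Y M s x + lin_form Y M t x"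
  by (simp add: lin_form_def distrib_left sum.distrib)

lemma lin_form_scale: "lin_form Y M (\<lambda>y. a * t y) x = a * lin_form Y M t x"
  by (simp add: lin_form_def sum_distrib_left mult.left_commute)

lemma lin_form_diff: "lin_form Y M (\<lambda>y. s y - t y) x = lin_form Y M s x - lin_form Y M t x"
  by (simp add: lin_form_def right_diff_distrib sum_subtractf)

lemma lin_form_sum: "lin_form Y M (\<lambda>y. \<Sum>i\<in>I. s i y) x = (\<Sum>i\<in>I. lin_form Y M (s i) x)"
  unfolding lin_form_def sum_distrib_left by (rule sum.swap)

lemma lin_form_single:
  assumes "finite Y" "y \<in> Y"
  shows "lin_form Y M (\<lambda>y'. of_bool (y' = y)) x = M x y"
  using assms by (simp add: lin_form_def of_bool_def if_distrib sum.delta' cong: if_cong)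

lemma lin_form_row_comb:
  assumes "\<forall>y\<in>Y. M x y = (\<Sum>i\<in>B. c i * M i y)"
  shows "lin_form Y M t x = (\<Sum>i\<in>B. c i * lin_form Y M t i)"
proof -
  have "lin_form Y M t x = (\<Sum>y\<in>Y. \<Sum>i\<in>B. c i * M i y * t y)"
    using assms by (simp add: lin_form_def sum_distrib_right)
  also have "\<dots> = (\<Sum>i\<in>B. \<Sum>y\<in>Y. c i * M i y * t y)" by (rule sum.swap)
  finally show ?thesis by (simp add: lin_form_def sum_distrib_left mult.assoc)
qed

section \<open>Separating forms and row bases\<close>

text \<open>Take the form that reads off a column \<open>y\<close> and subtract the interpolant of
  its values on \<open>B\<close>; the difference vanishes on \<open>B\<close>. For some
  \<open>y\<close> it is nonzero at \<open>x0\<close>, since otherwise row \<open>x0\<close> would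
  be a combination of the rows of \<open>B\<close>.\<close>

lemma separating_form:
  assumes "finite Y" "finite B" and ind: "rows_indep Y M B"
    and nsp: "\<not> rows_span Y M B {x0}"
  obtains d where "\<forall>x\<in>B. lin_form Y M d x = 0" "lin_form Y M d x0 = 1"
proof -
  have "\<exists>t. \<forall>j\<in>B. lin_form Y M t j = of_bool (i = j)" for i
    using ind[unfolded rows_indep_def, rule_format, of "\<lambda>j. of_bool (i = j)"] .
  then obtain D where D: "\<And>i j. j \<in> B \<Longrightarrow> lin_form Y M (D i) j = of_bool (i = j)"
    by metis
  have "\<forall>c. \<exists>y\<in>Y. M x0 y \<noteq> (\<Sum>i\<in>B. c i * M i y)"
    using nsp by (simp add: rows_span_def)
  \<comment> \<open>These coefficients are the values at \<open>x0\<close> of the dual forms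
    \<open>D i\<close>, so the inequality says exactly that the form \<open>d\<close> below is
    nonzero at \<open>x0\<close>.\<close>
  from this[rule_format, of "\<lambda>i. lin_form Y M (D i) x0"]
  obtain y where y: "y \<in> Y" "M x0 y \<noteq> (\<Sum>i\<in>B. lin_form Y M (D i) x0 * M i y)"
    by blast
  define d where "d = (\<lambda>y'. of_bool (y' = y) - (\<Sum>i\<in>B. M i y * D i y'))"
  have L: "lin_form Y M d x = M x y - (\<Sum>i\<in>B. M i y * lin_form Y M (D i) x)" for x
    unfolding d_def lin_form_diff lin_form_single[OF assms(1) y(1)] lin_form_sum lin_form_scale ..
  have 0: "lin_form Y M d x = 0" if "x \<in> B" for x
  proof -
    have "(\<Sum>i\<in>B. M i y * lin_form Y M (D i) x) = (\<Sum>i\<in>B. if x = i then M i y else 0)"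
      by (rule sum.cong) (use that in \<open>auto simp: D\<close>)
    then show ?thesis using that \<open>finite B\<close> by (simp add: L)
  qed
  have 1: "lin_form Y M d x0 \<noteq> 0"
    using y(2) by (simp add: L mult.commute)
  show thesis
    by (rule that[of "\<lambda>y. inverse (lin_form Y M d x0) * d y"])
      (use 0 1 in \<open>simp_all add: lin_form_scale\<close>)
qed

text \<open>A multiple of \<open>d\<close> adjusts the value at \<open>x0\<close> without disturbing
  the values on \<open>B\<close>.\<close>

lemma rows_indep_insert:
  assumes ind: "rows_indep Y M B"
    and d: "\<forall>x\<in>B. lin_form Y M d x = 0" "lin_form Y M d x0 = 1"
  shows "rows_indep Y M (insert x0 B)"
  unfolding rows_indep_def
proof
  fix c
  obtain t where t: "\<forall>x\<in>B. lin_form Y M t x = c x"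
    using ind unfolding rows_indep_def by blast
  show "\<exists>t. \<forall>x\<in>insert x0 B. lin_form Y M t x = c x"
    by (rule exI[of _ "\<lambda>y. t y + (c x0 - lin_form Y M t x0) * d y"])
      (use t d in \<open>auto simp: lin_form_add lin_form_scale\<close>)
qed

text \<open>A maximal independent subset spans, since a separating form for an unspanned row would
  allow it to be enlarged.\<close>

lemma row_basis_exists:
  assumes "finite Y" "finite P"
  obtains B where "B \<subseteq> P" "rows_indep Y M B" "rows_span Y M B P"
proof -
  let ?F = "{B \<in> Pow P. rows_indep Y M B}"
  have "finite ?F" using \<open>finite P\<close> by simp
  moreover have "{} \<in> ?F" by (simp add: rows_indep_def)
  ultimately have "\<exists>B\<in>?F. \<forall>C\<in>?F. B \<subseteq> C \<longrightarrow> B = C"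
    by (intro finite_has_maximal) auto
  then obtain B where B: "B \<in> ?F" and max: "\<forall>C\<in>?F. B \<subseteq> C \<longrightarrow> B = C" ..
  have "rows_span Y M B {x}" if x: "x \<in> P" for x
  proof (rule ccontr)
    assume n: "\<not> rows_span Y M B {x}"
    have "finite B" using B \<open>finite P\<close> finite_subset by blast
    then obtain d where d: "\<forall>x\<in>B. lin_form Y M d x = 0" "lin_form Y M d x = 1"
      using separating_form[OF \<open>finite Y\<close> _ _ n] B by blast
    then have "insert x B \<in> ?F" using rows_indep_insert[OF _ d] B x by simp
    then have "x \<in> B" using max by blast
    then show False using d by simp
  qed
  then have "rows_span Y M B P" by (simp add: rows_span_def)
  with B that show thesis by blast
qed

text \<open>A row outside the span of the support of \<open>lin_form Y M t\<close> admits a form \<open>d\<close> that vanishes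
  on this support but not at that row, so \<open>t + d\<close> has a larger support.\<close>

lemma maximal_support_spans:
  assumes "finite X" "finite Y" "finite B"
    and max: "\<And>s. card {x\<in>X. lin_form Y M s x \<noteq> 0} \<le> card {x\<in>X. lin_form Y M t x \<noteq> 0}"
    and ind: "rows_indep Y M B" and span: "rows_span Y M B {x\<in>X. lin_form Y M t x \<noteq> 0}"
  shows "rows_span Y M B X"
proof -
  let ?P = "\<lambda>t. {x\<in>X. lin_form Y M t x \<noteq> 0}"
  have "rows_span Y M B {x}" if x: "x \<in> X" for x
  proof (rule ccontr)
    assume n: "\<not> rows_span Y M B {x}"
    obtain d where d: "\<forall>x\<in>B. lin_form Y M d x = 0" "lin_form Y M d x = 1"
      using separating_form[OF assms(2,3) ind n] by blast
    \<comment> \<open>\<open>B\<close> spans the current support, so vanishing on \<open>B\<close>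
      propagates to all of it.\<close>
    have d0: "lin_form Y M d z = 0" if z: "z \<in> ?P t" for z
    proof -
      obtain c where c: "\<forall>y\<in>Y. M z y = (\<Sum>i\<in>B. c i * M i y)"
        using span[unfolded rows_span_def, rule_format, OF z] ..
      show ?thesis using d(1) by (simp add: lin_form_row_comb[OF c])
    qed
    have "x \<notin> ?P t" using d0[of x] d(2) by auto
    moreover have "insert x (?P t) \<subseteq> ?P (\<lambda>y. t y + d y)"
      using x d(2) d0 \<open>x \<notin> ?P t\<close> by (auto simp: lin_form_add)
    ultimately have "card (?P t) < card (?P (\<lambda>y. t y + d y))"
      using \<open>finite X\<close> by (intro psubset_card_mono) auto
    then show False using max[of "\<lambda>y. t y + d y"] by simp
  qed
  then show ?thesis by (simp add: rows_span_def)
qed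

section \<open>Bounding independent rows by a factorization\<close>

text \<open>By counting over the finite field F: independence makes all |F|^|B| value vectors on
  \<open>B\<close> occur, while the factorization determines each of them by |S| elements of
  F.\<close>

lemma rows_indep_card_le:
  fixes M :: "'a \<Rightarrow> 'b \<Rightarrow> 'f::field"
  assumes fin: "finite (UNIV :: 'f set)" "finite B" "finite S"
    and fac: "\<And>x y. x \<in> B \<Longrightarrow> y \<in> Y \<Longrightarrow> M x y = (\<Sum>v\<in>S. h x v * g v y)"
    and ind: "rows_indep Y M B"
  shows "card B \<le> card S"
proof -
  let ?F = "\<lambda>e. restrict (\<lambda>x. \<Sum>v\<in>S. h x v * e v) B"
  let ?U = "UNIV :: 'f set"
  have "B \<rightarrow>\<^sub>E ?U \<subseteq> ?F ` (S \<rightarrow>\<^sub>E ?U)"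
  proof
    fix c assume c: "c \<in> B \<rightarrow>\<^sub>E ?U"
    obtain t where t: "\<forall>x\<in>B. lin_form Y M t x = c x"
      using ind unfolding rows_indep_def by blast
    define e where "e = restrict (\<lambda>v. \<Sum>y\<in>Y. g v y * t y) S"
    have "(\<Sum>v\<in>S. h x v * e v) = c x" if x: "x \<in> B" for x
    proof -
      have "(\<Sum>v\<in>S. h x v * e v) = (\<Sum>v\<in>S. \<Sum>y\<in>Y. h x v * g v y * t y)"
        by (simp add: e_def sum_distrib_left mult.assoc)
      also have "\<dots> = (\<Sum>y\<in>Y. \<Sum>v\<in>S. h x v * g v y * t y)" by (rule sum.swap)
      also have "\<dots> = lin_form Y M t x"
        unfolding lin_form_def by (intro sum.cong) (simp_all add: fac[OF x] sum_distrib_right)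
      finally show ?thesis using t x by simp
    qed
    then have "?F e = c" using c by (auto simp: fun_eq_iff PiE_def extensional_def)
    moreover have "e \<in> S \<rightarrow>\<^sub>E ?U" by (simp add: e_def)
    ultimately show "c \<in> ?F ` (S \<rightarrow>\<^sub>E ?U)" by blast
  qed
  then have "card (B \<rightarrow>\<^sub>E ?U) \<le> card (S \<rightarrow>\<^sub>E ?U)"
    using fin by (meson surj_card_le finite_PiE)
  then have "card ?U ^ card B \<le> card ?U ^ card S"
    by (simp add: card_funcsetE fin)
  \<comment> \<open>The base of the powers is at least 2, so the exponents can be compared.\<close>
  moreover have "card {0, 1 :: 'f} \<le> card ?U" using fin by (intro card_mono) auto
  ultimately show ?thesis by (simp add: power_increasing_iff)
qed

section \<open>Large supports over the two-element field\<close>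

lemma bit_add_self: "a + a = (0 :: bit)"
  by (cases a) simp_all

lemma UNIV_bit: "(UNIV :: bit set) = {0, 1}"
  using bit_not_zero_iff by blast

text \<open>Flipping \<open>t\<close> at a nonzero entry of row \<open>x\<close> flips the form at \<open>x\<close>, so every nonzero row is in
  the support of exactly half of all forms; now average.\<close>

lemma large_support_exists:
  fixes M :: "'a \<Rightarrow> 'b \<Rightarrow> bit"
  assumes "finite X" "finite Y" and nz: "\<forall>x\<in>X. \<exists>y\<in>Y. M x y \<noteq> 0"
  obtains t where "card X \<le> 2 * card {x\<in>X. lin_form Y M t x \<noteq> 0}"
proof -
  let ?T = "Y \<rightarrow>\<^sub>E (UNIV :: bit set)"
  have finT: "finite ?T" using \<open>finite Y\<close> by (simp add: finite_PiE UNIV_bit)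
  have half: "2 * card {t\<in>?T. lin_form Y M t x \<noteq> 0} = card ?T" if x: "x \<in> X" for x
  proof -
    let ?A = "{t\<in>?T. lin_form Y M t x \<noteq> 0}" and ?B = "{t\<in>?T. lin_form Y M t x = 0}"
    obtain y where y: "y \<in> Y" "M x y = 1" using nz x by auto
    define fl where "fl t = t(y := t y + 1)" for t :: "'b \<Rightarrow> bit"
    have fl: "lin_form Y M (fl t) x = lin_form Y M t x + 1" for t
    proof -
      have "fl t = (\<lambda>y'. t y' + of_bool (y' = y))" by (auto simp: fl_def fun_eq_iff)
      then show ?thesis
        using lin_form_add[of Y M t "\<lambda>y'. of_bool (y' = y)" x]
          lin_form_single[OF \<open>finite Y\<close> y(1), of M x] y(2) by simp
    qed
    have flT: "fl t \<in> ?T" if "t \<in> ?T" for t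
      using that y(1) unfolding fl_def by (metis PiE_fun_upd UNIV_I insert_absorb)
    have "fl (fl t) = t" for t
      by (cases "t y") (auto simp: fl_def fun_eq_iff)
    then have "bij_betw fl ?A ?B"
      by (intro bij_betw_byWitness[of _ fl]) (use flT in \<open>auto simp: fl simp del: PiE_iff\<close>)
    then have "card ?A = card ?B" by (rule bij_betw_same_card)
    moreover have "card ?T = card ?A + card ?B"
      using finT by (subst card_Un_disjoint[symmetric]) (auto intro: arg_cong[where f = card])
    ultimately show ?thesis by simp
  qed
  show thesis
  proof (rule ccontr)
    assume "\<not> thesis"
    then have small: "2 * card {x\<in>X. lin_form Y M t x \<noteq> 0} < card X" for t
      using that[of t] by force
    \<comment> \<open>Count in two ways the pairs of a row \<open>x\<close> and a form
      \<open>t\<close> that is nonzero at \<open>x\<close>.\<close>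
    have "card X * card ?T = (\<Sum>x\<in>X. card ?T)" by simp
    also have "\<dots> = (\<Sum>x\<in>X. 2 * card {t\<in>?T. lin_form Y M t x \<noteq> 0})"
      by (intro sum.cong refl half[symmetric])
    also have "\<dots> = 2 * (\<Sum>x\<in>X. card {t\<in>?T. lin_form Y M t x \<noteq> 0})"
      by (rule sum_distrib_left[symmetric])
    also have "(\<Sum>x\<in>X. card {t\<in>?T. lin_form Y M t x \<noteq> 0}) =
        (\<Sum>t\<in>?T. card {x\<in>X. lin_form Y M t x \<noteq> 0})"
      by (rule sum_multicount_gen) (use \<open>finite X\<close> finT in blast)+
    also have "2 * \<dots> = (\<Sum>t\<in>?T. 2 * card {x\<in>X. lin_form Y M t x \<noteq> 0})"
      by (rule sum_distrib_left)
    also have "\<dots> < (\<Sum>t\<in>?T. card X)"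
      using finT small by (intro sum_strict_mono) auto
    finally show False by simp
  qed
qed

text \<open>A largest support is at least as large as the one from
  \<open>large_support_exists\<close>, and by \<open>maximal_support_spans\<close> a basis of it
  spans all rows.\<close>

lemma spanning_support_exists:
  fixes M :: "'a \<Rightarrow> 'b \<Rightarrow> bit"
  assumes fin: "finite X" "finite Y" and nz: "\<forall>x\<in>X. \<exists>y\<in>Y. M x y \<noteq> 0"
  obtains t B where "card X \<le> 2 * card {x\<in>X. lin_form Y M t x \<noteq> 0}"
    "B \<subseteq> {x\<in>X. lin_form Y M t x \<noteq> 0}" "rows_indep Y M B" "rows_span Y M B X"
proof -
  let ?P = "\<lambda>t. {x\<in>X. lin_form Y M t x \<noteq> 0}"
  \<comment> \<open>Here \<open>t\<close> ranges over all functions on the type, so the maximum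
    comes from bounding the support sizes; the bound is strict, hence the
    \<open>+ 1\<close>.\<close>
  have "\<forall>t. True \<longrightarrow> card (?P t) < card X + 1"
    using fin by (auto simp: less_Suc_eq_le intro!: card_mono)
  then obtain t where t: "\<And>s. card (?P s) \<le> card (?P t)"
    using ex_has_greatest_nat[of "\<lambda>_. True" undefined "\<lambda>t. card (?P t)" "card X + 1"] by blast
  obtain s where "card X \<le> 2 * card (?P s)" using large_support_exists[OF assms] .
  with t[of s] have 1: "card X \<le> 2 * card (?P t)" by linarith
  obtain B where B: "B \<subseteq> ?P t" "rows_indep Y M B" "rows_span Y M B (?P t)"
    using row_basis_exists[of Y "?P t" M] fin by auto
  have "finite B" using B(1) fin(1) finite_subset by fastforce
  from maximal_support_spans[OF fin this t B(2,3)] have "rows_span Y M B X" .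
  with 1 B that show thesis by blast
qed

text \<open>Keep all of \<open>P - B\<close> and correct the sum with rows of the spanning set \<open>B\<close>.\<close>

lemma large_subset_with_prescribed_sum:
  fixes M :: "'a \<Rightarrow> 'b \<Rightarrow> bit"
  assumes "finite X" "B \<subseteq> P" "P \<subseteq> X" and span: "rows_span Y M B X"
  obtains A where "A \<subseteq> P" "card P \<le> card A + card B"
    "\<forall>y\<in>Y. (\<Sum>x\<in>A. M x y) = lin_form X (\<lambda>y x. M x y) s y"
proof -
  have fin: "finite P" "finite B" using assms finite_subset by metis+
  obtain c where c: "\<And>x y. x \<in> X \<Longrightarrow> y \<in> Y \<Longrightarrow> M x y = (\<Sum>i\<in>B. c x i * M i y)"
    using span unfolding rows_span_def by metis
  \<comment> \<open>In characteristic 2, \<open>B\<close> has to contribute the target plus the sum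
    over \<open>P - B\<close>. The coefficients of this combination of rows of \<open>X\<close> are
    \<open>u\<close>, and \<open>e\<close> rewrites it in terms of \<open>B\<close>.\<close>
  define u where "u x = s x + of_bool (x \<in> P - B)" for x
  define e where "e i = (\<Sum>x\<in>X. u x * c x i)" for i
  define A where "A = (P - B) \<union> {i\<in>B. e i = 1}"
  have "(\<Sum>x\<in>A. M x y) = lin_form X (\<lambda>y x. M x y) s y" if y: "y \<in> Y" for y
  proof -
    let ?R = "\<Sum>x\<in>P - B. M x y"
    have "(\<Sum>i\<in>B. e i * M i y) = (\<Sum>i\<in>B. \<Sum>x\<in>X. u x * (c x i * M i y))"
      by (simp only: e_def sum_distrib_right mult.assoc)
    also have "\<dots> = (\<Sum>x\<in>X. u x * M x y)"
      by (subst sum.swap) (simp only: c[OF _ y] sum_distrib_left cong: sum.cong)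
    also have "\<dots> = lin_form X (\<lambda>y x. M x y) s y + (\<Sum>x\<in>X. of_bool (x \<in> P - B) * M x y)"
      unfolding u_def lin_form_def distrib_right sum.distrib by (simp only: mult.commute[of "s _"])
    also have "(\<Sum>x\<in>X. of_bool (x \<in> P - B) * M x y) = ?R"
      by (rule sum.mono_neutral_cong_right) (use assms in auto)
    finally have 1: "(\<Sum>i\<in>B. e i * M i y) = lin_form X (\<lambda>y x. M x y) s y + ?R" .
    have "(\<Sum>i\<in>{i\<in>B. e i = 1}. M i y) = (\<Sum>i\<in>B. e i * M i y)"
      by (rule sum.mono_neutral_cong_left) (use fin in auto)
    moreover have "(\<Sum>x\<in>A. M x y) = ?R + (\<Sum>i\<in>{i\<in>B. e i = 1}. M i y)"
      unfolding A_def by (rule sum.union_disjoint) (use fin in auto)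
    ultimately have "(\<Sum>x\<in>A. M x y) = lin_form X (\<lambda>y x. M x y) s y + (?R + ?R)"
      using 1 by (simp only: ac_simps)
    then show ?thesis by (simp only: bit_add_self add_0_right)
  qed
  moreover have "A \<subseteq> P" using \<open>B \<subseteq> P\<close> by (auto simp: A_def)
  moreover have "card P \<le> card A + card B"
  proof -
    have "card P \<le> card (A \<union> B)"
      using fin by (intro card_mono) (auto simp: A_def)
    also have "\<dots> \<le> card A + card B" by (rule card_Un_le)
    finally show ?thesis .
  qed
  ultimately show thesis using that by blast
qed

section \<open>Factorization through the rank\<close>

text \<open>\<open>S\<close> is a maximal independent set of columns, and \<open>a v j\<close> are
  the coefficients of column \<open>j\<close> over it.\<close>

lemma (in vec_space) rank_factorization:
  assumes A: "A \<in> carrier_mat n nc"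
  obtains S a where "finite S" "card S = rank A"
    "\<And>i j. i < n \<Longrightarrow> j < nc \<Longrightarrow> A $$ (i, j) = (\<Sum>v\<in>S. v $ i * a v j)"
proof -
  have cA: "set (cols A) \<subseteq> carrier_vec n" using A cols_dim by blast
  have "lin_indpt {}" by (simp add: lin_dep_def)
  then obtain U where U: "maximal U (\<lambda>T. T \<subseteq> set (cols A) \<and> lin_indpt T)"
    using maximal_exists_superset[of "set (cols A)" "\<lambda>T. T \<subseteq> set (cols A) \<and> lin_indpt T" "{}"]
    by auto
  then have US: "U \<subseteq> set (cols A)" "lin_indpt U" unfolding maximal_def by auto
  have finU: "finite U" using US(1) finite_subset by blast
  have Uc: "U \<subseteq> carrier_vec n" using US cA by blast
  have "\<exists>b. \<forall>i<n. A $$ (i, j) = (\<Sum>v\<in>U. v $ i * b v)" if j: "j < nc" for j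
  proof -
    have cj: "col A j \<in> set (cols A)" using j A by (auto simp: cols_def)
    have "col A j \<in> span U"
    proof (rule ccontr)
      assume n: "col A j \<notin> span U"
      then have "lin_indpt (U \<union> {col A j})"
        using lin_dep_iff_in_span[of U "col A j"] Uc US(2) cj cA n span_mem by blast
      then have "U \<union> {col A j} = U" using U cj US(1) unfolding maximal_def by blast
      then have "col A j \<in> U" by blast
      then show False using n span_mem[OF Uc] by blast
    qed
    then obtain b where "col A j = lincomb b U" using finite_span[OF finU] Uc by auto
    then have "A $$ (i, j) = (\<Sum>v\<in>U. v $ i * b v)" if "i < n" for i
      using lincomb_index[OF that Uc, of b] that j A by (auto simp: mult.commute[of "b _"] simp flip: index_col)
    then show ?thesis by blast
  qed
  then obtain a where "\<And>i j. j < nc \<Longrightarrow> i < n \<Longrightarrow> A $$ (i, j) = (\<Sum>v\<in>U. v $ i * a j v)"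
    by metis
  then show thesis
    using that[of U "\<lambda>v j. a j v"] finU rank_card_indpt[OF A U] by simp
qed

section \<open>Odd induced subgraphs\<close>

lemma of_nat_bit_eq_0_iff: "(of_nat n :: bit) = 0 \<longleftrightarrow> even n"
  by (induction n) auto

lemma f_o_ge:
  assumes "finite V" "S \<subseteq> V" "\<forall>v\<in>S. odd (card {u\<in>S. E v u})"
  shows "card S \<le> f_o V E"
proof -
  let ?C = "{card S | S. S \<subseteq> V \<and> (\<forall>v\<in>S. odd (vertex_degree S (induced_edges E S) v))}"
  have "?C \<subseteq> card ` Pow V" by auto
  then have "finite ?C" using \<open>finite V\<close> by (meson finite_Pow_iff finite_imageI finite_subset)
  moreover have "card S \<in> ?C"
    using assms by (auto simp: vertex_degree_def induced_edges_def intro!: exI[of _ S])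
  ultimately show ?thesis unfolding f_o_def by (rule Max_ge)
qed

theorem corollary15:
  fixes V X Y :: "'a set" and E :: "'a \<Rightarrow> 'a \<Rightarrow> bool"
    and xs ys :: "'a list" and n k :: nat
  assumes "simple_graph V E"
    and "n = card V"
    and "bipartition V E X Y"
    and "distinct xs" and "set xs = X"
    and "distinct ys" and "set ys = Y"
    and "k = vec_space.rank (length xs) (bipartite_adj_mat E xs ys)"
    and "min_degree V E \<ge> 1"
  shows "real (f_o V E) \<ge> real n / 2 - 2 * real k"
proof -
  define M :: "'a \<Rightarrow> 'a \<Rightarrow> bit" where "M x y = of_bool (E x y)" for x y
  let ?N = "\<lambda>y x. M x y"
  have finV: "finite V" and sym: "E u v = E v u" for u v
    using assms(1) by (auto simp: simple_graph_def symp_def)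
  have XY: "X \<union> Y = V" "X \<inter> Y = {}"
    and bip: "E u v \<Longrightarrow> (u \<in> X \<and> v \<in> Y) \<or> (u \<in> Y \<and> v \<in> X)" for u v
    using assms(3) by (auto simp: bipartition_def)
  have fin: "finite X" "finite Y" using finV XY(1) by auto
  have nbr: "\<exists>u. E v u" if "v \<in> V" for v
  proof -
    have "min_degree V E \<le> enat (vertex_degree V E v)"
      unfolding min_degree_def using that by (rule INF_lower)
    then have "1 \<le> enat (vertex_degree V E v)" using assms(9) by (rule order_trans[rotated])
    then have "vertex_degree V E v \<noteq> 0" by (auto simp: one_enat_def)
    then show ?thesis
      unfolding vertex_degree_def by (metis (mono_tags, lifting) card.empty empty_Collect_eq)
  qed
  have nzX: "\<forall>x\<in>X. \<exists>y\<in>Y. M x y \<noteq> 0" and nzY: "\<forall>y\<in>Y. \<exists>x\<in>X. ?N y x \<noteq> 0"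
    using nbr bip XY sym unfolding M_def by (auto; blast)+

  obtain S :: "bit vec set" and a where S: "finite S" "card S = k"
    "\<And>i j. i < length xs \<Longrightarrow> j < length ys \<Longrightarrow>
       bipartite_adj_mat E xs ys $$ (i, j) = (\<Sum>v\<in>S. v $ i * a v j)"
    using vec_space.rank_factorization[of "bipartite_adj_mat E xs ys" "length xs" "length ys"]
      assms(8) by (auto simp: bipartite_adj_mat_def)
  \<comment> \<open>List positions carry the factorization over from matrix indices to
    vertices.\<close>
  define ix where "ix x = (SOME i. i < length xs \<and> xs ! i = x)" for x
  define iy where "iy y = (SOME j. j < length ys \<and> ys ! j = y)" for y
  have ix: "ix x < length xs \<and> xs ! ix x = x" if "x \<in> X" for x
    unfolding ix_def by (rule someI_ex) (use that assms(5) in \<open>auto simp: in_set_conv_nth\<close>)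
  have iy: "iy y < length ys \<and> ys ! iy y = y" if "y \<in> Y" for y
    unfolding iy_def by (rule someI_ex) (use that assms(7) in \<open>auto simp: in_set_conv_nth\<close>)
  have fac: "M x y = (\<Sum>v\<in>S. v $ ix x * a v (iy y))" if "x \<in> X" "y \<in> Y" for x y
    using S(3)[of "ix x" "iy y"] ix[OF that(1)] iy[OF that(2)]
    by (simp add: M_def bipartite_adj_mat_def of_bool_def)

  obtain t B where t: "card X \<le> 2 * card {x\<in>X. lin_form Y M t x \<noteq> 0}"
    "B \<subseteq> {x\<in>X. lin_form Y M t x \<noteq> 0}" "rows_indep Y M B" "rows_span Y M B X"
    by (rule spanning_support_exists[OF fin nzX])
  obtain s C where s: "card Y \<le> 2 * card {y\<in>Y. lin_form X ?N s y \<noteq> 0}"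
    "C \<subseteq> {y\<in>Y. lin_form X ?N s y \<noteq> 0}" "rows_indep X ?N C" "rows_span X ?N C Y"
    by (rule spanning_support_exists[OF fin(2,1) nzY])
  have finB: "finite B" "finite C" using t(2) s(2) fin by (auto intro: finite_subset)
  have finU: "finite (UNIV :: bit set)" by (simp add: UNIV_bit)
  have B: "card B \<le> k"
    unfolding S(2)[symmetric] using fac t(2)
    by (intro rows_indep_card_le[OF finU finB(1) S(1) _ t(3)]) auto
  \<comment> \<open>Swapping the factors factorizes the transpose over the same \<open>S\<close>, so
    independent columns obey the same bound.\<close>
  have C: "card C \<le> k"
    unfolding S(2)[symmetric]
    by (rule rows_indep_card_le[OF finU finB(2) S(1) _ s(3),
          where h = "\<lambda>y v. a v (iy y)" and g = "\<lambda>v x. v $ ix x"])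
      (use fac s(2) in \<open>auto simp: mult.commute simp del: mult_bit_eq_and\<close>)
  \<comment> \<open>The two forms are crossed: the row sum of \<open>A\<close> is the form of
    \<open>s\<close>, nonzero on \<open>D\<close>, and the column sum of \<open>D\<close> is the
    form of \<open>t\<close>, nonzero on \<open>A\<close>.\<close>
  obtain A where A: "A \<subseteq> {x\<in>X. lin_form Y M t x \<noteq> 0}"
    "card {x\<in>X. lin_form Y M t x \<noteq> 0} \<le> card A + card B"
    "\<forall>y\<in>Y. (\<Sum>x\<in>A. M x y) = lin_form X ?N s y"
    using large_subset_with_prescribed_sum[OF fin(1) t(2) _ t(4), of s] by auto
  obtain D where D: "D \<subseteq> {y\<in>Y. lin_form X ?N s y \<noteq> 0}"
    "card {y\<in>Y. lin_form X ?N s y \<noteq> 0} \<le> card D + card C"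
    "\<forall>x\<in>X. (\<Sum>y\<in>D. M x y) = lin_form Y M t x"
    using large_subset_with_prescribed_sum[OF fin(2) s(2) _ s(4), of t] by auto
  have AD: "A \<subseteq> X" "D \<subseteq> Y" "finite A" "finite D" using A(1) D(1) fin by (auto intro: finite_subset)
  \<comment> \<open>A sum of bits is a count modulo 2, so a nonzero sum means an odd degree.\<close>
  have sumM: "(\<Sum>y\<in>F. of_bool (E v y)) = (of_nat (card {u\<in>F. E v u}) :: bit)"
    if "finite F" for F v
    using that by (simp add: of_bool_def sum.If_cases Int_def)
  have "odd (card {u \<in> A \<union> D. E v u})" if v: "v \<in> A \<union> D" for v
    using v
  proof
    assume v: "v \<in> A"
    then have "{u \<in> A \<union> D. E v u} = {u \<in> D. E v u}" using AD XY(2) bip by blast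
    moreover have "(\<Sum>y\<in>D. M v y) \<noteq> 0" using v A(1) D(3) by auto
    ultimately show ?thesis using sumM[OF AD(4), of v] by (simp add: M_def of_nat_bit_eq_0_iff)
  next
    assume v: "v \<in> D"
    then have "{u \<in> A \<union> D. E v u} = {u \<in> A. E v u}" using AD XY(2) bip by blast
    moreover have "(\<Sum>x\<in>A. M x v) \<noteq> 0" using v D(1) A(3) by auto
    ultimately show ?thesis
      using sumM[OF AD(3), of v] by (simp add: M_def sym[of _ v] of_nat_bit_eq_0_iff)
  qed
  then have "card (A \<union> D) \<le> f_o V E"
    using AD XY(1) finV by (intro f_o_ge) auto
  moreover have "card (A \<union> D) = card A + card D"
    using AD XY(2) by (intro card_Un_disjoint) auto
  moreover have "n = card X + card Y"
    using assms(2) XY fin by (metis card_Un_disjoint)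
  moreover have "card X \<le> 2 * (card A + card B)" "card Y \<le> 2 * (card D + card C)"
    by (rule order_trans[OF t(1) mult_le_mono2[OF A(2)]],
        rule order_trans[OF s(1) mult_le_mono2[OF D(2)]])
  \<comment> \<open>|X| is at most 2|A| + 2k and |Y| at most 2|D| + 2k, while |A| + |D| is at most
    \<open>f_o V E\<close>.\<close>
  ultimately have "n \<le> 2 * f_o V E + 4 * k"
    using B C unfolding distrib_left by linarith
  then show ?thesis by linarith
qed

end
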